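(* Suppose that for each $i\in I$ there are $\theta_i\in(0,1]$ and $H_i>0$ with $\|\nabla f_i(x)-\nabla f_i(y)\|\le H_i\|y-x\|^{\theta_i}$ for all $x,y\in\Omega$, and that there exists $f_i^*\in\mathbb{R}$ such that $f_i(x)\ge f_i^*$ for all $x\in\Omega$. Let $\delta_{\min}\in(0,1)$ and $\delta_k\in[\delta_{\min},1]$ for all $k\ge1$, and let $\{x_k\}_{k\ge0}$ be generated by the Universal Nonmonotone Line Search Method with the choice $\nu_{k,\ell}=\nu_k$ for all $\ell$, where $$\nu_0=0,\qquad \nu_k=(1-\delta_k)\left(F(x_{k-1})+\nu_{k-1}-F(x_k)\right)\ \text{ for } k\ge1 .$$ Let $\theta_{\min}=\min_{i\in I}\theta_i$. Then the method takes at most $\mathcal{O}\left(\epsilon^{-\left(1+\frac1{\theta_{\min}}\right)}\right)$ iterations to generate an $\epsilon$-approximate Pareto critical point; that is, there is a constant $C>0$, depending only on $c_1,c_2,\beta,\rho,\delta_{\min}$ and on $\theta_i$, $H_i$, $f_i(x_0)-f_i^*$ ($i\in I$), such that for every $\epsilon\in(0,1)$ and every $T$ with $\|s(x_k)\|>\epsilon$ for $k=0,\ldots,T-1$ one has $T\le C\,\epsilon^{-\left(1+\frac1{\theta_{\min}}\right)}$.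
   Context: Setting: $\emptyset\ne\Omega\subset\mathbb{R}^n$ is closed and convex, $F=(f_1,\ldots,f_m)^T:\mathbb{R}^n\to\mathbb{R}^m$ is continuously differentiable (possibly nonconvex), $I=\{1,\ldots,m\}$, $\|\cdot\|$ is the Euclidean norm. For $x\in\Omega$, $\Omega-x=\{y\in\mathbb{R}^n: y+x\in\Omega\}$, and $s(x)$ is the unique minimizer over $d\in\Omega-x$ of $\max_{i\in I}\{\nabla f_i(x)^Td\}+\frac12\|d\|^2$. A point $x\in\Omega$ is an $\epsilon$-approximate Pareto critical point when $\|s(x)\|\le\epsilon$. Universal Nonmonotone Line Search Method. Parameters: $x_0\in\Omega$, $m_0\in\{0,1,\ldots,m\}$, $c_1,c_2>0$, $\beta,\rho\in(0,1)$. At each iteration $k=0,1,2,\ldots$: (Step 1) choose $d(x_k)\in\Omega-x_k$ with $\max_{i\in I}\{\nabla f_i(x_k)^Td(x_k)\}\le-c_1\|s(x_k)\|^2$ and $\|d(x_k)\|\le c_2\|s(x_k)\|$. (Step 2) For $\ell=0,1,2,\ldots$ choose a vector $\nu_{k,\ell}$ (here by the rule given in the claim), and let $\ell_k$ be the first $\ell$ for which both of the following hold: (i) the number of indices $i\in I$ with $f_i(x_k+\beta^\ell d(x_k))\le f_i(x_k)+\rho\beta^\ell\nabla f_i(x_k)^Td(x_k)$ is at least $m_k$; (ii) $f_i(x_k+\beta^\ell d(x_k))\le f_i(x_k)+\rho\beta^\ell\nabla f_i(x_k)^Td(x_k)+[\nu_{k,\ell}]_i$ for all $i\in I$. (Step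 3) Set $\alpha_k=\beta^{\ell_k}$, $x_{k+1}=x_k+\alpha_kd(x_k)$, $\nu_k=\nu_{k,\ell_k}$, and choose $m_{k+1}\in\{0,1,\ldots,m\}$ (arbitrarily). *)

theory Defs
  imports "HOL-Analysis.Analysis"
begin

(* The complexity constant must not depend on the dimension n, so n has to be quantified
   inside the statement and cannot be a type index as in real ^ 'n.  R^n is therefore taken
   to be the subspace Rn n of the inner product space of finitely supported real sequences:
   the sequences vanishing from index n on, with the standard inner product (inner_Rn) and
   the Euclidean norm (norm_Rn). *)

typedef finseq = "{f :: nat \<Rightarrow> real. finite {i. f i \<noteq> 0}}"
  morphisms coord Abs_finseq
  by (rule exI[of _ "\<lambda>_. 0"]) simp

setup_lifting type_definition_finseq

lemma finite_support [simp]: "finite {i. coord x i \<noteq> 0}"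
  using coord[of x] by simp

lemma finseq_eqI: "(\<And>i. coord x i = coord y i) \<Longrightarrow> x = y"
  by (simp add: coord_inject[symmetric] ext)

instantiation finseq :: real_vector
begin

lift_definition zero_finseq :: finseq is "\<lambda>_. 0" by simp

lift_definition plus_finseq :: "finseq \<Rightarrow> finseq \<Rightarrow> finseq" is "\<lambda>f g i. f i + g i"
  subgoal for f g by (rule finite_subset[of _ "{i. f i \<noteq> 0} \<union> {i. g i \<noteq> 0}"]) auto
  done

lift_definition minus_finseq :: "finseq \<Rightarrow> finseq \<Rightarrow> finseq" is "\<lambda>f g i. f i - g i"
  subgoal for f g by (rule finite_subset[of _ "{i. f i \<noteq> 0} \<union> {i. g i \<noteq> 0}"]) auto
  done

lift_definition uminus_finseq :: "finseq \<Rightarrow> finseq" is "\<lambda>f i. - f i"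
  by simp

lift_definition scaleR_finseq :: "real \<Rightarrow> finseq \<Rightarrow> finseq" is "\<lambda>r f i. r * f i"
  by (rule finite_subset) auto

instance
proof
  fix x y z :: finseq and r s :: real
  show "x + y + z = x + (y + z)" by transfer (simp add: add.assoc)
  show "x + y = y + x" by transfer (simp add: add.commute)
  show "0 + x = x" by transfer simp
  show "- x + x = 0" by transfer simp
  show "x - y = x + - y" by transfer simp
  show "r *\<^sub>R (x + y) = r *\<^sub>R x + r *\<^sub>R y" by transfer (simp add: distrib_left)
  show "(r + s) *\<^sub>R x = r *\<^sub>R x + s *\<^sub>R x" by transfer (simp add: distrib_right)
  show "r *\<^sub>R s *\<^sub>R x = (r * s) *\<^sub>R x" by transfer (simp add: mult.assoc)
  show "1 *\<^sub>R x = x" by transfer simp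
qed

end

instantiation finseq :: real_inner
begin

definition inner_finseq :: "finseq \<Rightarrow> finseq \<Rightarrow> real"
  where "inner_finseq x y = (\<Sum>i | coord x i \<noteq> 0. coord x i * coord y i)"

definition norm_finseq :: "finseq \<Rightarrow> real"
  where "norm_finseq x = sqrt (inner x x)"

definition dist_finseq :: "finseq \<Rightarrow> finseq \<Rightarrow> real"
  where "dist_finseq x y = norm (x - y)"

definition sgn_finseq :: "finseq \<Rightarrow> finseq"
  where "sgn_finseq x = x /\<^sub>R norm x"

definition uniformity_finseq :: "(finseq \<times> finseq) filter"
  where "uniformity_finseq = (INF e\<in>{0 <..}. principal {(x, y). dist x y < e})"

definition open_finseq :: "finseq set \<Rightarrow> bool"
  where "open_finseq U \<longleftrightarrow> (\<forall>x\<in>U. \<forall>\<^sub>F (x', y) in uniformity. x' = x \<longrightarrow> y \<in> U)"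

lemma inner_finseq_superset:
  assumes "finite A" "{i. coord x i \<noteq> 0} \<subseteq> A"
  shows "inner x y = (\<Sum>i\<in>A. coord x i * coord y i)"
  unfolding inner_finseq_def by (rule sum.mono_neutral_left) (use assms in auto)

instance
proof
  fix x y z :: finseq and r :: real
  show "sgn x = x /\<^sub>R norm x" by (rule sgn_finseq_def)
  show "dist x y = norm (x - y)" by (rule dist_finseq_def)
  show "(uniformity :: (finseq \<times> finseq) filter) =
      (INF e\<in>{0 <..}. principal {(x, y). dist x y < e})"
    by (rule uniformity_finseq_def)
  show "open U \<longleftrightarrow> (\<forall>x\<in>U. \<forall>\<^sub>F (x', y) in uniformity. x' = x \<longrightarrow> y \<in> U)" for U :: "finseq set"
    by (rule open_finseq_def)
  let ?A = "{i. coord x i \<noteq> 0} \<union> {i. coord y i \<noteq> 0}"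
  have A: "finite ?A" by simp
  show "inner x y = inner y x"
    using inner_finseq_superset[OF A, of x y] inner_finseq_superset[OF A, of y x]
    by (simp add: mult.commute)
  have "inner (x + y) z = (\<Sum>i\<in>?A. coord (x + y) i * coord z i)"
    by (rule inner_finseq_superset[OF A]) (auto simp: plus_finseq.rep_eq)
  then show "inner (x + y) z = inner x z + inner y z"
    using inner_finseq_superset[OF A, of x z] inner_finseq_superset[OF A, of y z]
    by (simp add: plus_finseq.rep_eq distrib_right sum.distrib)
  have "inner (r *\<^sub>R x) y = (\<Sum>i | coord x i \<noteq> 0. coord (r *\<^sub>R x) i * coord y i)"
    by (rule inner_finseq_superset) (auto simp: scaleR_finseq.rep_eq)
  then show "inner (r *\<^sub>R x) y = r * inner x y"
    by (simp add: scaleR_finseq.rep_eq inner_finseq_def sum_distrib_left mult.assoc)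
  show "0 \<le> inner x x"
    by (simp add: inner_finseq_def sum_nonneg)
  show "inner x x = 0 \<longleftrightarrow> x = 0"
    by (auto simp: inner_finseq_def sum_nonneg_eq_0_iff zero_finseq.rep_eq intro: finseq_eqI)
  show "norm x = sqrt (inner x x)" by (rule norm_finseq_def)
qed

end

definition Rn :: "nat \<Rightarrow> finseq set"
  where "Rn n = {x. \<forall>i\<ge>n. coord x i = 0}"

lemma bij_betw_coord_Rn: "bij_betw coord (Rn n) {f. \<forall>i\<ge>n. f i = 0}"
proof (rule bij_betwI')
  fix f :: "nat \<Rightarrow> real"
  assume f: "f \<in> {f. \<forall>i\<ge>n. f i = 0}"
  then have "{i. f i \<noteq> 0} \<subseteq> {..<n}" by (force simp: not_le[symmetric])
  then have "finite {i. f i \<noteq> 0}" by (rule finite_subset) simp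
  then have "coord (Abs_finseq f) = f" by (simp add: Abs_finseq_inverse)
  then show "\<exists>x\<in>Rn n. f = coord x" using f by (intro bexI[of _ "Abs_finseq f"]) (auto simp: Rn_def)
qed (auto simp: Rn_def coord_inject)

lemma inner_Rn: "x \<in> Rn n \<Longrightarrow> inner x y = (\<Sum>i<n. coord x i * coord y i)"
  by (rule inner_finseq_superset) (auto simp: Rn_def not_le[symmetric])

lemma norm_Rn: "x \<in> Rn n \<Longrightarrow> norm x = sqrt (\<Sum>i<n. (coord x i)\<^sup>2)"
  by (simp add: norm_eq_sqrt_inner inner_Rn power2_eq_square)

(* f is continuously differentiable on R^n and g is its gradient field; only the values of
   f and g on Rn n matter. *)
definition C1_with_gradient :: "nat \<Rightarrow> (finseq \<Rightarrow> real) \<Rightarrow> (finseq \<Rightarrow> finseq) \<Rightarrow> bool"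
  where "C1_with_gradient n f g \<longleftrightarrow>
    (\<forall>x\<in>Rn n. g x \<in> Rn n \<and> (f has_derivative (\<lambda>h. inner (g x) h)) (at x within Rn n)) \<and>
    continuous_on (Rn n) g"

definition shifted :: "finseq set \<Rightarrow> finseq \<Rightarrow> finseq set"
  where "shifted \<Omega> x = {y. y + x \<in> \<Omega>}"

definition max_slope :: "('m::finite \<Rightarrow> finseq \<Rightarrow> finseq) \<Rightarrow> finseq \<Rightarrow> finseq \<Rightarrow> real"
  where "max_slope g x d = Max (range (\<lambda>i. inner (g i x) d))"

definition steepest_dir ::
    "finseq set \<Rightarrow> ('m::finite \<Rightarrow> finseq \<Rightarrow> finseq) \<Rightarrow> finseq \<Rightarrow> finseq"
  where "steepest_dir \<Omega> g x =
    (THE d. is_arg_min (\<lambda>d. max_slope g x d + (norm d)\<^sup>2 / 2) (\<lambda>d. d \<in> shifted \<Omega> x) d)"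

definition sufficient_decrease ::
    "real \<Rightarrow> (finseq \<Rightarrow> real ^ 'm) \<Rightarrow> ('m::finite \<Rightarrow> finseq \<Rightarrow> finseq) \<Rightarrow>
     finseq \<Rightarrow> finseq \<Rightarrow> real \<Rightarrow> real \<Rightarrow> 'm \<Rightarrow> bool"
  where "sufficient_decrease \<rho> F g x d t r i \<longleftrightarrow>
    F (x + t *\<^sub>R d) $ i \<le> F x $ i + \<rho> * t * inner (g i x) d + r"

definition step_accepted ::
    "real \<Rightarrow> (finseq \<Rightarrow> real ^ 'm) \<Rightarrow> ('m::finite \<Rightarrow> finseq \<Rightarrow> finseq) \<Rightarrow>
     finseq \<Rightarrow> finseq \<Rightarrow> nat \<Rightarrow> real ^ 'm \<Rightarrow> real \<Rightarrow> bool"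
  where "step_accepted \<rho> F g x d mk v t \<longleftrightarrow>
    mk \<le> card {i. sufficient_decrease \<rho> F g x d t 0 i} \<and>
    (\<forall>i. sufficient_decrease \<rho> F g x d t (v $ i) i)"

(* ms k is the number m_k, \<nu> k l the vector chosen in the l-th trial of iteration k, and
   ls k the index of the accepted trial. *)
definition universal_nonmonotone_line_search ::
    "real \<Rightarrow> real \<Rightarrow> real \<Rightarrow> real \<Rightarrow> finseq set \<Rightarrow> (finseq \<Rightarrow> real ^ 'm) \<Rightarrow>
     ('m::finite \<Rightarrow> finseq \<Rightarrow> finseq) \<Rightarrow> (nat \<Rightarrow> nat) \<Rightarrow> (nat \<Rightarrow> nat \<Rightarrow> real ^ 'm) \<Rightarrow>
     (nat \<Rightarrow> finseq) \<Rightarrow> (nat \<Rightarrow> finseq) \<Rightarrow> (nat \<Rightarrow> nat) \<Rightarrow> bool"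
  where "universal_nonmonotone_line_search c1 c2 \<beta> \<rho> \<Omega> F g ms \<nu> x d ls \<longleftrightarrow>
    x 0 \<in> \<Omega> \<and>
    (\<forall>k. ms k \<le> CARD('m) \<and>
      d k \<in> shifted \<Omega> (x k) \<and>
      max_slope g (x k) (d k) \<le> - c1 * (norm (steepest_dir \<Omega> g (x k)))\<^sup>2 \<and>
      norm (d k) \<le> c2 * norm (steepest_dir \<Omega> g (x k)) \<and>
      step_accepted \<rho> F g (x k) (d k) (ms k) (\<nu> k (ls k)) (\<beta> ^ ls k) \<and>
      (\<forall>l<ls k. \<not> step_accepted \<rho> F g (x k) (d k) (ms k) (\<nu> k l) (\<beta> ^ l)) \<and>
      x (Suc k) = x k + \<beta> ^ ls k *\<^sub>R d k)"

end

(* The vector F(x k) + nu k is a Lyapunov function: the line search gives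
   F(x (k+1)) <= F(x k) + nu k - rho c1 alpha_k |s(x k)|^2 in every component, and the update
   of nu passes on at least the fraction delta_min of this decrease, while keeping nu >= 0.
   On the other hand, Hoelder continuity of the gradients makes every trial step below
   kappa * eps^(1/theta_min - 1) acceptable as long as |s(x k)| > eps, so alpha_k cannot drop
   below beta times this threshold.  Each iteration therefore decreases F + nu by a multiple
   of eps^(1 + 1/theta_min). *)
theory Submission
  imports Defs
begin

text \<open>The mean value theorem on the segment from \<open>x\<close> to \<open>y\<close> yields a
  point where the slope is attained. By Cauchy-Schwarz and Hoelder continuity, that slope differs
  from the one at \<open>x\<close> by at most \<open>H * norm (y - x) powr (1 + \<theta>)\<close>.
  Integrating along the segment would improve \<open>H\<close> to \<open>H / (1 + \<theta>)\<close>,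
  which only affects constants.\<close>

lemma holder_gradient_upper_bound:
  fixes f :: "'a::real_inner \<Rightarrow> real"
  assumes S: "convex S" "x \<in> S" "y \<in> S"
    and deriv: "\<And>z. z \<in> S \<Longrightarrow> (f has_derivative (\<lambda>h. inner (g z) h)) (at z within S)"
    and holder: "\<And>y z. y \<in> S \<Longrightarrow> z \<in> S \<Longrightarrow> norm (g y - g z) \<le> H * norm (z - y) powr \<theta>"
    and "0 \<le> H" "0 \<le> \<theta>"
  shows "f y \<le> f x + inner (g x) (y - x) + H * norm (y - x) powr (1 + \<theta>)"
proof -
  define \<gamma> where "\<gamma> t = x + t *\<^sub>R (y - x)" for t :: real
  have \<gamma>S: "\<gamma> t \<in> S" if "t \<in> {0..1}" for t
    using convexD_alt[OF S, of t] that by (simp add: \<gamma>_def algebra_simps)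
  have d\<gamma>: "(\<gamma> has_derivative (\<lambda>h. h *\<^sub>R (y - x))) (at t within {0..1})" for t
    unfolding \<gamma>_def by (auto intro!: derivative_eq_intros)
  have df: "((\<lambda>t. f (\<gamma> t)) has_derivative (\<lambda>h. inner (g (\<gamma> t)) (h *\<^sub>R (y - x))))
      (at t within {0..1})" if "t \<in> {0..1}" for t
    by (rule has_derivative_in_compose2[where t = S, OF deriv _ _ d\<gamma>]) (use \<gamma>S that in auto)
  obtain u where u: "u \<in> {0..1}"
      and "f (\<gamma> 1) - f (\<gamma> 0) = inner (g (\<gamma> u)) ((1 - 0) *\<^sub>R (y - x))"
    using mvt_very_simple[of 0 1 "\<lambda>t. f (\<gamma> t)" "\<lambda>t h. inner (g (\<gamma> t)) (h *\<^sub>R (y - x))"] df by auto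
  then have "f y - f x = inner (g x) (y - x) + inner (g (\<gamma> u) - g x) (y - x)"
    by (simp add: \<gamma>_def inner_diff_left)
  also have "inner (g (\<gamma> u) - g x) (y - x) \<le> norm (g (\<gamma> u) - g x) * norm (y - x)"
    by (rule norm_cauchy_schwarz)
  also have "\<dots> \<le> H * norm (y - x) powr \<theta> * norm (y - x)"
  proof (rule mult_right_mono)
    have "norm (x - \<gamma> u) = u * norm (y - x)"
      using u by (simp add: \<gamma>_def)
    also have "\<dots> \<le> norm (y - x)"
      using u by (simp add: mult_left_le_one_le)
    finally have "norm (x - \<gamma> u) powr \<theta> \<le> norm (y - x) powr \<theta>"
      using \<open>0 \<le> \<theta>\<close> by (intro powr_mono2) auto
    then show "norm (g (\<gamma> u) - g x) \<le> H * norm (y - x) powr \<theta>"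
      using holder[OF \<gamma>S[OF u] S(2)] \<open>0 \<le> H\<close> by (meson mult_left_mono order_trans)
  qed simp
  also have "\<dots> = H * norm (y - x) powr (1 + \<theta>)"
    by (simp add: powr_mult_base[symmetric] mult_ac)
  finally show ?thesis by simp
qed

text \<open>Here \<open>D\<close> stands for the length of the search direction. After division by
  \<open>t\<close>, the claim follows from
  \<open>t powr \<theta> \<le> A * s powr (1 - \<theta>)\<close> with
  \<open>A = a / (H * c powr (1 + \<theta>))\<close>. Since \<open>\<theta> \<le> 1\<close>,
  replacing \<open>s\<close> by its lower bound \<open>\<epsilon>\<close> only strengthens this,
  which gives a threshold for \<open>t\<close> that is independent of \<open>s\<close>.\<close>

lemma holder_remainder_le_slope:
  fixes a H c \<theta> \<epsilon> s t D :: real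
  assumes "0 < a" "0 < H" "0 < c" "0 < \<theta>" "\<theta> \<le> 1"
    and "0 < \<epsilon>" "\<epsilon> \<le> s" "0 < t" "0 \<le> D" "D \<le> c * s"
    and t: "t \<le> (a / (H * c powr (1 + \<theta>))) powr (1 / \<theta>) * \<epsilon> powr (1 / \<theta> - 1)"
  shows "H * (t * D) powr (1 + \<theta>) \<le> t * a * s\<^sup>2"
proof -
  define A where "A = a / (H * c powr (1 + \<theta>))"
  have "0 < A" "0 < s" using assms by (auto simp: A_def)
  have "t powr \<theta> \<le> (A powr (1 / \<theta>) * \<epsilon> powr (1 / \<theta> - 1)) powr \<theta>"
    using assms by (intro powr_mono2) (auto simp: A_def)
  also have "\<dots> = A * \<epsilon> powr (1 - \<theta>)"
    using \<open>0 < A\<close> assms by (simp add: powr_mult powr_powr algebra_simps)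
  also have "\<dots> \<le> A * s powr (1 - \<theta>)"
    using \<open>0 < A\<close> assms by (intro mult_left_mono powr_mono2) auto
  finally have *: "t powr \<theta> \<le> A * s powr (1 - \<theta>)" .
  have "H * (t * D) powr (1 + \<theta>) \<le> H * (t * (c * s)) powr (1 + \<theta>)"
    using assms by (intro mult_left_mono powr_mono2) auto
  also have "\<dots> = H * (t * t powr \<theta>) * (c powr (1 + \<theta>) * s powr (1 + \<theta>))"
    using assms \<open>0 < s\<close> by (simp add: powr_mult powr_mult_base)
  also have "\<dots> \<le> H * (t * (A * s powr (1 - \<theta>))) * (c powr (1 + \<theta>) * s powr (1 + \<theta>))"
    using assms * by (intro mult_right_mono mult_left_mono) auto
  also have "\<dots> = t * (A * (H * c powr (1 + \<theta>))) * (s powr (1 - \<theta>) * s powr (1 + \<theta>))"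
    by (simp add: mult_ac)
  also have "A * (H * c powr (1 + \<theta>)) = a"
    using assms by (simp add: A_def)
  also have "s powr (1 - \<theta>) * s powr (1 + \<theta>) = s\<^sup>2"
    using \<open>0 < s\<close> by (simp add: powr_add[symmetric])
  finally show ?thesis .
qed

lemma inner_le_max_slope: "inner (g i x) d \<le> max_slope g x d"
  unfolding max_slope_def by (rule Max_ge) auto

text \<open>The Hoelder bound contains the full slope term \<open>t * inner (g i x) d\<close>. A
  fraction \<rho> of it is kept for the decrease condition; the remaining fraction is at most
  \<open>- t * (1 - \<rho>) * c1 * s\<^sup>2\<close>, enough to absorb the remainder when
  \<open>t\<close> is below the threshold. The slack \<open>r\<close> lets the two acceptance tests
  share this result: \<open>r = 0\<close> for the count, \<open>r = v $ i\<close> for the relaxed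
  test.\<close>

lemma sufficient_decrease_holder:
  fixes F :: "finseq \<Rightarrow> real ^ 'm::finite"
  assumes C1: "C1_with_gradient n (\<lambda>y. F y $ i) (g i)"
    and \<Omega>: "\<Omega> \<subseteq> Rn n" "convex \<Omega>" "x \<in> \<Omega>" "d \<in> shifted \<Omega> x"
    and holder: "\<And>y z. y \<in> \<Omega> \<Longrightarrow> z \<in> \<Omega> \<Longrightarrow> norm (g i y - g i z) \<le> H * norm (z - y) powr \<theta>"
    and pos: "0 < H" "0 < \<theta>" "\<theta> \<le> 1" "0 < c1" "0 < c2" "\<rho> < 1" "0 < \<epsilon>" "\<epsilon> \<le> s"
    and slope: "max_slope g x d \<le> - c1 * s\<^sup>2" and d: "norm d \<le> c2 * s"
    and t: "0 < t" "t \<le> 1"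
      "t \<le> ((1 - \<rho>) * c1 / (H * c2 powr (1 + \<theta>))) powr (1 / \<theta>) * \<epsilon> powr (1 / \<theta> - 1)"
    and "0 \<le> r"
  shows "sufficient_decrease \<rho> F g x d t r i"
proof -
  have "x + t *\<^sub>R d \<in> \<Omega>"
    using convexD_alt[OF \<Omega>(2,3), of "d + x" t] \<Omega>(4) t by (simp add: shifted_def algebra_simps)
  moreover have "((\<lambda>y. F y $ i) has_derivative (\<lambda>h. inner (g i z) h)) (at z within \<Omega>)"
    if "z \<in> \<Omega>" for z
    using C1 that \<Omega>(1) by (auto simp: C1_with_gradient_def intro: has_derivative_subset)
  ultimately have "F (x + t *\<^sub>R d) $ i \<le> F x $ i + inner (g i x) ((x + t *\<^sub>R d) - x)
      + H * norm ((x + t *\<^sub>R d) - x) powr (1 + \<theta>)"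
    using \<Omega> holder pos by (intro holder_gradient_upper_bound[where S = \<Omega>]) auto
  also have "\<dots> = F x $ i + t * inner (g i x) d + H * (t * norm d) powr (1 + \<theta>)"
    using t by simp
  finally have "F (x + t *\<^sub>R d) $ i \<le> F x $ i + t * inner (g i x) d + H * (t * norm d) powr (1 + \<theta>)" .
  moreover have "H * (t * norm d) powr (1 + \<theta>) \<le> t * ((1 - \<rho>) * c1) * s\<^sup>2"
    using pos d t by (intro holder_remainder_le_slope[where c = c2 and \<epsilon> = \<epsilon>]) auto
  moreover have "t * (1 - \<rho>) * inner (g i x) d \<le> t * (1 - \<rho>) * (- c1 * s\<^sup>2)"
    using inner_le_max_slope[of g i x d] slope pos t by (intro mult_left_mono) auto
  ultimately show ?thesis
    using \<open>0 \<le> r\<close> by (simp add: sufficient_decrease_def algebra_simps)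
qed

text \<open>Either the first trial step 1 was accepted, or the trial just before the accepted one
  was rejected and hence exceeded \<tau>; backtracking costs one more factor \<beta>.\<close>

lemma step_length_lower_bound:
  fixes F :: "finseq \<Rightarrow> real ^ 'm::finite"
  assumes "mk \<le> CARD('m)" "\<And>i. 0 \<le> v $ i" "0 < \<beta>" "\<beta> \<le> 1" "\<tau> \<le> 1"
    and sufficient: "\<And>t r i. 0 < t \<Longrightarrow> t \<le> 1 \<Longrightarrow> t \<le> \<tau> \<Longrightarrow> 0 \<le> r \<Longrightarrow> sufficient_decrease \<rho> F g x d t r i"
    and rejected: "\<forall>l'<l. \<not> step_accepted \<rho> F g x d mk v (\<beta> ^ l')"
  shows "\<beta> * \<tau> \<le> \<beta> ^ l"
proof (cases l)
  case 0
  have "\<beta> * \<tau> \<le> \<beta>"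
    using assms(3,5) by (intro mult_left_le) auto
  with assms(4) show ?thesis by (simp add: 0)
next
  case (Suc l')
  \<comment> \<open>With \<open>r = 0\<close> all \<open>CARD('m)\<close> indices pass the strict
    test, so the count is large enough for every admissible \<open>mk\<close>.\<close>
  have "step_accepted \<rho> F g x d mk v t" if "0 < t" "t \<le> 1" "t \<le> \<tau>" for t
    using sufficient[OF that] assms(1,2) by (simp add: step_accepted_def)
  from this[of "\<beta> ^ l'"] have "\<tau> < \<beta> ^ l'"
    using rejected[rule_format, of l'] assms(3,4)
    by (intro not_le_imp_less notI) (simp add: Suc power_le_one)
  with assms(3) show ?thesis by (simp add: Suc)
qed

theorem mainTheorem4:
  fixes c1 c2 \<beta> \<rho> \<delta>min :: real
    and \<theta> H gap :: "'m::finite \<Rightarrow> real"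
  assumes "c1 > 0" and "c2 > 0"
    and "\<beta> \<in> {0<..<1}" and "\<rho> \<in> {0<..<1}" and "\<delta>min \<in> {0<..<1}"
    and "\<And>i. \<theta> i \<in> {0<..1}" and "\<And>i. H i > 0"
  shows "\<exists>C>0. \<forall>(n::nat) (\<Omega> :: finseq set) (F :: finseq \<Rightarrow> real ^ 'm)
      (g :: 'm \<Rightarrow> finseq \<Rightarrow> finseq) (fstar :: 'm \<Rightarrow> real)
      (x :: nat \<Rightarrow> finseq) (d :: nat \<Rightarrow> finseq) (ms :: nat \<Rightarrow> nat) (ls :: nat \<Rightarrow> nat)
      (\<delta> :: nat \<Rightarrow> real) (\<nu> :: nat \<Rightarrow> real ^ 'm).
      \<Omega> \<noteq> {} \<and> \<Omega> \<subseteq> Rn n \<and> closed \<Omega> \<and> convex \<Omega> \<and>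
      (\<forall>i. C1_with_gradient n (\<lambda>y. F y $ i) (g i)) \<and>
      (\<forall>i. \<forall>y\<in>\<Omega>. \<forall>z\<in>\<Omega>. norm (g i y - g i z) \<le> H i * norm (z - y) powr \<theta> i) \<and>
      (\<forall>i. \<forall>y\<in>\<Omega>. fstar i \<le> F y $ i) \<and>
      (\<forall>i. F (x 0) $ i - fstar i = gap i) \<and>
      (\<forall>k\<ge>1. \<delta> k \<in> {\<delta>min..1}) \<and>
      \<nu> 0 = 0 \<and>
      (\<forall>k\<ge>1. \<nu> k = (1 - \<delta> k) *\<^sub>R (F (x (k - 1)) + \<nu> (k - 1) - F (x k))) \<and>
      universal_nonmonotone_line_search c1 c2 \<beta> \<rho> \<Omega> F g ms (\<lambda>k l. \<nu> k) x d ls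
      \<longrightarrow> (\<forall>\<epsilon>\<in>{0<..<1}. \<forall>T::nat.
            (\<forall>k<T. norm (steepest_dir \<Omega> g (x k)) > \<epsilon>) \<longrightarrow>
            real T \<le> C * \<epsilon> powr (- (1 + 1 / Min (range \<theta>))))"
proof -
  define \<theta>min where "\<theta>min = Min (range \<theta>)"
  \<comment> \<open>The threshold factor of \<open>holder_remainder_le_slope\<close> for
    \<open>a = (1 - \<rho>) * c1\<close> and \<open>c = c2\<close>.\<close>
  define A where "A i = ((1 - \<rho>) * c1 / (H i * c2 powr (1 + \<theta> i))) powr (1 / \<theta> i)" for i
  \<comment> \<open>The minimum over \<open>A\<close> serves all objectives at once; the cap 1 will
    give \<open>\<tau> \<le> 1\<close>.\<close>
  define \<kappa> where "\<kappa> = min 1 (Min (range A))"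
  define D where "D = \<delta>min * \<rho> * c1 * \<beta> * \<kappa>"
  \<comment> \<open>An arbitrary objective: the Lyapunov decrease holds in every component, so one
    of them bounds the number of iterations.\<close>
  define i0 :: 'm where "i0 = undefined"
  have \<theta>min: "\<theta>min \<le> \<theta> i" for i
    unfolding \<theta>min_def by (rule Min_le) auto
  have "\<theta>min \<in> range \<theta>"
    unfolding \<theta>min_def by (rule Min_in) auto
  then have "0 < \<theta>min" "\<theta>min \<le> 1" using assms(6) by auto
  have \<theta>: "0 < \<theta> i" "\<theta> i \<le> 1" for i using assms(6)[of i] by auto
  have "0 < A i" for i
    using assms(1-4) assms(7)[of i] by (auto simp: A_def)
  then have "0 < \<kappa>" by (auto simp: \<kappa>_def)
  have \<kappa>: "\<kappa> \<le> 1" "\<kappa> \<le> A i" for i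
    by (auto simp: \<kappa>_def min.coboundedI2)
  have "0 < D" using assms(1-5) \<open>0 < \<kappa>\<close> by (simp add: D_def)
  \<comment> \<open>Chosen before the dimension, the problem and the iterates are fixed. The
    absolute value and the added 1 make \<open>C\<close> positive, since nothing is known about the
    sign of \<open>gap\<close> at this point.\<close>
  define C where "C = (\<bar>gap i0\<bar> + 1) / D"
  have "0 < C" using \<open>0 < D\<close> by (simp add: C_def)
  show ?thesis
  proof (intro exI[of _ C] conjI \<open>0 < C\<close> allI impI ballI, elim conjE)
    fix n \<Omega> F g fstar x d ms ls \<delta> \<epsilon> and \<nu> :: "nat \<Rightarrow> real ^ 'm" and T :: nat
    assume \<Omega>: "\<Omega> \<subseteq> Rn n" "convex \<Omega>"
      and C1: "\<forall>i. C1_with_gradient n (\<lambda>y. F y $ i) (g i)"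
      and holder: "\<forall>i. \<forall>y\<in>\<Omega>. \<forall>z\<in>\<Omega>. norm (g i y - g i z) \<le> H i * norm (z - y) powr \<theta> i"
      and fstar: "\<forall>i. \<forall>y\<in>\<Omega>. fstar i \<le> F y $ i"
      and gap: "\<forall>i. F (x 0) $ i - fstar i = gap i"
      and \<delta>: "\<forall>k\<ge>1. \<delta> k \<in> {\<delta>min..1}"
      and \<nu>0: "\<nu> 0 = 0"
      and \<nu>: "\<forall>k\<ge>1. \<nu> k = (1 - \<delta> k) *\<^sub>R (F (x (k - 1)) + \<nu> (k - 1) - F (x k))"
      and line_search: "universal_nonmonotone_line_search c1 c2 \<beta> \<rho> \<Omega> F g ms (\<lambda>k l. \<nu> k) x d ls"
      and \<epsilon>: "\<epsilon> \<in> {0<..<1}"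
      and noncritical: "\<forall>k<T. norm (steepest_dir \<Omega> g (x k)) > \<epsilon>"
    define s where "s k = norm (steepest_dir \<Omega> g (x k))" for k
    define \<alpha> where "\<alpha> k = \<beta> ^ ls k" for k
    have \<alpha>: "0 < \<alpha> k" "\<alpha> k \<le> 1" for k
      using assms(3) by (auto simp: \<alpha>_def power_le_one)
    have x0: "x 0 \<in> \<Omega>"
      and ms: "ms k \<le> CARD('m)"
      and dk: "d k \<in> shifted \<Omega> (x k)"
      and slope: "max_slope g (x k) (d k) \<le> - c1 * (s k)\<^sup>2"
      and nd: "norm (d k) \<le> c2 * s k"
      and accepted: "step_accepted \<rho> F g (x k) (d k) (ms k) (\<nu> k) (\<alpha> k)"
      and rejected: "\<forall>l<ls k. \<not> step_accepted \<rho> F g (x k) (d k) (ms k) (\<nu> k) (\<beta> ^ l)"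
      and step: "x (Suc k) = x k + \<alpha> k *\<^sub>R d k" for k
      using line_search by (simp_all add: universal_nonmonotone_line_search_def s_def \<alpha>_def)
    have x\<Omega>: "x k \<in> \<Omega>" for k
    proof (induction k)
      case (Suc k)
      then show ?case
        using convexD_alt[OF \<Omega>(2) Suc, of "d k + x k" "\<alpha> k"] dk[of k] \<alpha>[of k]
        by (simp add: step shifted_def algebra_simps)
    qed (rule x0)
    have decrease: "F (x (Suc k)) $ i \<le> F (x k) $ i + \<nu> k $ i - \<rho> * c1 * \<alpha> k * (s k)\<^sup>2" for k i
    proof -
      have "F (x (Suc k)) $ i \<le> F (x k) $ i + \<rho> * \<alpha> k * inner (g i (x k)) (d k) + \<nu> k $ i"
        using accepted[of k] by (simp add: step_accepted_def sufficient_decrease_def step)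
      also have "\<rho> * \<alpha> k * inner (g i (x k)) (d k) \<le> \<rho> * \<alpha> k * (- c1 * (s k)\<^sup>2)"
        using inner_le_max_slope[of g i "x k" "d k"] slope[of k] assms(4) \<alpha>[of k]
        by (intro mult_left_mono) auto
      finally show ?thesis by (simp add: algebra_simps)
    qed
    have \<nu>Suc: "\<nu> (Suc k) $ i = (1 - \<delta> (Suc k)) * (F (x k) $ i + \<nu> k $ i - F (x (Suc k)) $ i)" for k i
      using \<nu> by simp
    have \<delta>Suc: "\<delta>min \<le> \<delta> (Suc k)" "\<delta> (Suc k) \<le> 1" for k using \<delta> by auto
    have descent: "0 \<le> \<rho> * c1 * \<alpha> k * (s k)\<^sup>2" for k
      using assms(1,4) \<alpha>[of k] by simp
    have \<nu>_nonneg: "0 \<le> \<nu> k $ i" for k i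
    proof (cases k)
      case (Suc j)
      show ?thesis
        unfolding Suc \<nu>Suc
        using \<delta>Suc(2)[of j] decrease[of j i] descent[of j] by (intro mult_nonneg_nonneg) auto
    qed (simp add: \<nu>0)
    \<comment> \<open>By the update rule, \<open>F + \<nu>\<close> drops by exactly
      \<open>\<delta> (Suc k)\<close> times the bracket in \<open>\<nu>Suc\<close>, which
      \<open>decrease\<close> bounds from below.\<close>
    have lyapunov: "F (x (Suc k)) $ i + \<nu> (Suc k) $ i
        \<le> F (x k) $ i + \<nu> k $ i - \<delta>min * (\<rho> * c1 * \<alpha> k * (s k)\<^sup>2)" for k i
    proof -
      have "\<delta>min * (\<rho> * c1 * \<alpha> k * (s k)\<^sup>2)
          \<le> \<delta> (Suc k) * (F (x k) $ i + \<nu> k $ i - F (x (Suc k)) $ i)"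
        using \<delta>Suc(1)[of k] decrease[of k i] descent[of k] assms(5) by (intro mult_mono) auto
      then show ?thesis by (simp add: \<nu>Suc algebra_simps)
    qed
    define \<tau> where "\<tau> = \<kappa> * \<epsilon> powr (1 / \<theta>min - 1)"
    \<comment> \<open>As \<open>\<epsilon> < 1\<close>, a larger exponent gives a smaller power, so
      the smallest \<theta> yields a threshold valid for all objectives.\<close>
    have \<tau>A: "\<tau> \<le> A i * \<epsilon> powr (1 / \<theta> i - 1)" for i
      unfolding \<tau>_def using \<kappa>(2)[of i] \<epsilon> \<theta>min[of i] \<open>0 < \<theta>min\<close> \<open>0 < \<kappa>\<close>
      by (intro mult_mono powr_mono') (auto intro!: divide_left_mono)
    have "\<epsilon> powr (1 / \<theta>min - 1) \<le> \<epsilon> powr 0"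
      using \<epsilon> \<open>0 < \<theta>min\<close> \<open>\<theta>min \<le> 1\<close> by (intro powr_mono') auto
    then have "\<tau> \<le> 1"
      using \<epsilon> \<kappa>(1) \<open>0 < \<kappa>\<close> by (auto simp: \<tau>_def intro!: mult_le_one)
    have step_length: "\<beta> * \<tau> \<le> \<alpha> k" if "k < T" for k
      unfolding \<alpha>_def
    proof (rule step_length_lower_bound[OF ms \<nu>_nonneg _ _ \<open>\<tau> \<le> 1\<close> _ rejected])
      fix t r :: real and i :: 'm
      assume t: "0 < t" "t \<le> 1" "t \<le> \<tau>" and "0 \<le> r"
      show "sufficient_decrease \<rho> F g (x k) (d k) t r i"
      proof (rule sufficient_decrease_holder[where n = n and \<Omega> = \<Omega> and H = "H i" and \<theta> = "\<theta> i"
            and \<epsilon> = \<epsilon> and s = "s k" and ?c1.0 = c1 and ?c2.0 = c2])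
        show "\<epsilon> \<le> s k" using noncritical that by (auto simp: s_def)
        show "t \<le> ((1 - \<rho>) * c1 / (H i * c2 powr (1 + \<theta> i))) powr (1 / \<theta> i) * \<epsilon> powr (1 / \<theta> i - 1)"
          using t(3) \<tau>A[of i] by (simp add: A_def)
      qed (use C1 \<Omega> x\<Omega> dk holder assms \<theta> \<epsilon> slope nd t \<open>0 \<le> r\<close> in auto)
    qed (use assms(3) in auto)
    have progress: "D * \<epsilon> powr (1 + 1 / \<theta>min) \<le> \<delta>min * (\<rho> * c1 * \<alpha> k * (s k)\<^sup>2)" if "k < T" for k
    proof -
      \<comment> \<open>The exponent splits into \<open>1 / \<theta>min - 1\<close>, contributed by
        the step length, and 2, contributed by the squared norm of the steepest descent
        direction.\<close>
      have "\<epsilon> powr (1 + 1 / \<theta>min) = \<epsilon> powr ((1 / \<theta>min - 1) + 2)"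
        by simp
      also have "\<dots> = \<epsilon> powr (1 / \<theta>min - 1) * \<epsilon>\<^sup>2"
        using \<epsilon> by (simp only: powr_add) simp
      finally have "D * \<epsilon> powr (1 + 1 / \<theta>min) = \<delta>min * (\<rho> * c1 * ((\<beta> * \<tau>) * \<epsilon>\<^sup>2))"
        by (simp add: D_def \<tau>_def)
      also have "(\<beta> * \<tau>) * \<epsilon>\<^sup>2 \<le> \<alpha> k * (s k)\<^sup>2"
        using step_length[OF that] noncritical that \<epsilon> \<alpha>[of k]
        by (intro mult_mono power_mono) (auto simp: s_def intro: less_imp_le)
      finally show ?thesis using assms by (simp add: mult_ac)
    qed
    \<comment> \<open>Telescoping from \<open>\<nu> 0 = 0\<close>. At \<open>k = T\<close>,
      nonnegativity of \<nu> and the lower bound \<open>fstar\<close> limit the total decrease by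
      \<open>gap i0\<close>.\<close>
    have "F (x k) $ i0 + \<nu> k $ i0 \<le> F (x 0) $ i0 - real k * (D * \<epsilon> powr (1 + 1 / \<theta>min))"
      if "k \<le> T" for k
      using that
    proof (induction k)
      case (Suc k)
      then show ?case using lyapunov[of k i0] progress[of k] by (simp add: algebra_simps)
    qed (simp add: \<nu>0)
    from this[OF order_refl] have "real T * (D * \<epsilon> powr (1 + 1 / \<theta>min)) \<le> \<bar>gap i0\<bar> + 1"
      using fstar[rule_format, OF x\<Omega>, of i0 T] gap[rule_format, of i0] \<nu>_nonneg[of T i0]
      by linarith
    then show "real T \<le> C * \<epsilon> powr (- (1 + 1 / Min (range \<theta>)))"
      using \<open>0 < D\<close> \<epsilon> unfolding C_def \<theta>min_def[symmetric] powr_minus by (simp add: field_simps)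
  qed
qed

end
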